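(* Let $K \subset \mathbb{R}^d$ be a compact convex set and let $C \subset K$ be a closed subset such that $\operatorname{bd}(K) \subset C$ and $K = \operatorname{co}(C)$. If $f \colon C \to \mathbb{R}$ is continuous and convex, then the convex roof $\widehat{f}$ of $f$ is a (real-valued) continuous convex function on $K$ that extends $f$, i.e. $\widehat{f}|_C = f$.
   Context: For a convex set $K \subset \mathbb{R}^d$, $\operatorname{ri}(K)$ denotes its relative interior (the interior of $K$ inside its affine hull) and $\operatorname{bd}(K) = \overline{K} \setminus \operatorname{ri}(K)$ its relative boundary; $\operatorname{co}$ denotes convex hull. A function $f \colon C \to \mathbb{R}$ on a (not necessarily convex) set $C \subset \mathbb{R}^d$ is called convex if $f(x) \le \sum_{j=1}^k t_j f(x_j)$ for any finite collection $x, x_1,\dots,x_k \in C$ and $t_1,\dots,t_k \in [0,1]$ with $\sum_j t_j = 1$ and $\sum_j t_j x_j = x$. The convex roof of $f \colon C \to \mathbb{R}$ is the function $\widehat{f} \colon \operatorname{co}(C) \to \mathbb{R} \cup \{-\infty\}$, $\widehat{f}(x) = \inf \sum_j t_j f(x_j)$, the infimum taken over all ways of writing $x = \sum_j t_j x_j$ as a finite convex combination of points $x_j \in C$ ($t_j \in [0,1]$, $\sum_j t_j = 1$). *)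

theory Defs
  imports "HOL-Analysis.Analysis"
begin

definition is_convex_comb ::
  "'a::real_vector set \<Rightarrow> nat \<Rightarrow> (nat \<Rightarrow> real) \<Rightarrow> (nat \<Rightarrow> 'a) \<Rightarrow> 'a \<Rightarrow> bool" where
  "is_convex_comb C k t p x \<longleftrightarrow>
     (\<forall>j\<in>{1..k}. p j \<in> C \<and> t j \<in> {0..1}) \<and>
     (\<Sum>j=1..k. t j) = 1 \<and> (\<Sum>j=1..k. t j *\<^sub>R p j) = x"

text \<open>Convexity of a function on a set that need not be convex. The library's
  \<^const>\<open>convex_on\<close> includes convexity of the domain, so it does not apply to
  general \<open>C\<close>.\<close>

definition convex_fun_on :: "'a::real_vector set \<Rightarrow> ('a \<Rightarrow> real) \<Rightarrow> bool" where
  "convex_fun_on C f \<longleftrightarrow>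
     (\<forall>x\<in>C. \<forall>k t p. is_convex_comb C k t p x \<longrightarrow> f x \<le> (\<Sum>j=1..k. t j * f (p j)))"

text \<open>The infimum is taken in the extended reals, since it may be \<open>-\<infinity>\<close>. The roof is
  meaningful only on \<open>convex hull C\<close>; elsewhere it is the infimum of the empty set,
  namely \<open>\<infinity>\<close>.\<close>

definition convex_roof :: "'a::real_vector set \<Rightarrow> ('a \<Rightarrow> real) \<Rightarrow> 'a \<Rightarrow> ereal" where
  "convex_roof C f x =
     Inf {ereal (\<Sum>j=1..k. t j * f (p j)) | k t p. is_convex_comb C k t p x}"

end

theory Submission
  imports Defs
begin

text \<open>
  Let \<open>H\<close> be the convex hull of the graph of \<open>f\<close>. The values \<open>\<Sum>j. t j * f (p j)\<close> that compete in
  the infimum defining the roof at \<open>x\<close> are exactly the heights \<open>r\<close> with \<open>(x, r) \<in> H\<close>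
  (\<open>convex_hull_graph_eq\<close>), so the roof is the lower boundary of \<open>H\<close>. As \<open>C\<close> is compact and \<open>f\<close>
  continuous, \<open>H\<close> is compact, and the infimum is a minimum (\<open>convex_roof_attained\<close>). Hence the
  roof \<open>g\<close> is real-valued; it is convex because \<open>H\<close> is; and it agrees with \<open>f\<close> on \<open>C\<close>
  because convexity of \<open>f\<close> says precisely that no point of \<open>H\<close> lies below the graph of \<open>f\<close>.

  Both halves of continuity rest on one principle (\<open>compact_fibre_eventually_subset\<close>): the vertical
  fibres of a compact set cannot jump outwards. Applied to \<open>H\<close>, it shows that \<open>g\<close> is lower
  semicontinuous. Upper semicontinuity fails for lower boundaries of general compact convex sets;
  this is where the hypothesis on the relative boundary enters. On it \<open>g\<close> equals the continuous
  function \<open>f\<close>. Fix \<open>z\<close> in the relative interior and join \<open>(z, g z)\<close> by segments to all points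
  \<open>(y, g y)\<close> with \<open>y\<close> in the relative boundary. By convexity this compact cone lies on or above the
  graph of \<open>g\<close>, it covers \<open>K\<close>, and it touches the graph over \<open>z\<close> and over the relative
  boundary. The fibre principle for the cone therefore bounds \<open>g\<close> from above near such points; a
  point of the relative interior is treated by taking it as the apex \<open>z\<close>
  (\<open>convex_on_upper_semicontinuous\<close>).
\<close>

text \<open>The part of \<open>S\<close> outside \<open>UNIV \<times> V\<close> is compact, so its projection is a closed set, and \<open>a\<close>
  avoids that set.\<close>

lemma compact_fibre_eventually_subset:
  fixes S :: "('a::metric_space \<times> 'b::metric_space) set"
  assumes "compact S" and "open V" and fibre: "\<And>r. (a, r) \<in> S \<Longrightarrow> r \<in> V"
  shows "\<exists>d>0. \<forall>x r. dist x a < d \<longrightarrow> (x, r) \<in> S \<longrightarrow> r \<in> V"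
proof -
  have "compact (S - UNIV \<times> V)"
    by (intro compact_diff \<open>compact S\<close> open_Times open_UNIV \<open>open V\<close>)
  then have "closed (fst ` (S - UNIV \<times> V))"
    by (intro compact_imp_closed compact_continuous_image continuous_intros)
  moreover have "a \<notin> fst ` (S - UNIV \<times> V)"
    using fibre by auto
  ultimately obtain d where "d > 0" and d: "\<And>x. dist x a < d \<Longrightarrow> x \<notin> fst ` (S - UNIV \<times> V)"
    by (metis Compl_iff open_Compl open_dist)
  have "r \<in> V" if "dist x a < d" "(x, r) \<in> S" for x r
    using d[OF that(1)] that(2) by force
  with \<open>d > 0\<close> show ?thesis by blast
qed

text \<open>A convex combination of points of the graph carries the barycentre in its first component and
  the averaged value of \<open>f\<close> in its second. This turns questions about the roof into geometry of one
  convex set.\<close>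

lemma convex_hull_graph_eq:
  "(x, r) \<in> convex hull ((\<lambda>x. (x, f x)) ` C) \<longleftrightarrow>
     (\<exists>k t p. is_convex_comb C k t p x \<and> (\<Sum>j=1..k. t j * f (p j)) = r)"
  (is "_ \<longleftrightarrow> ?R")
proof
  assume "(x, r) \<in> convex hull ((\<lambda>x. (x, f x)) ` C)"
  then obtain k t q where
    q: "\<forall>j\<in>{1::nat..k}. 0 \<le> t j \<and> q j \<in> (\<lambda>x. (x, f x)) ` C"
      "sum t {1..k} = 1" "(\<Sum>j=1..k. t j *\<^sub>R q j) = (x, r)"
    unfolding convex_hull_indexed by blast
  have le1: "t j \<le> 1" if "j \<in> {1..k}" for j
    using member_le_sum[of j "{1..k}" t] that q(1,2) by auto
  have snd_q: "snd (q j) = f (fst (q j))" if "j \<in> {1..k}" for j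
    using q(1) that by fastforce
  have "(\<Sum>j=1..k. t j *\<^sub>R fst (q j)) = x"
    using arg_cong[OF q(3), of fst] by (simp add: fst_sum)
  moreover have "(\<Sum>j=1..k. t j * f (fst (q j))) = (\<Sum>j=1..k. t j * snd (q j))"
    by (intro sum.cong refl) (simp add: snd_q)
  then have "(\<Sum>j=1..k. t j * f (fst (q j))) = r"
    using arg_cong[OF q(3), of snd] by (simp add: snd_sum)
  moreover have "\<forall>j\<in>{1..k}. fst (q j) \<in> C \<and> t j \<in> {0..1}"
    using q(1) le1 by fastforce
  ultimately show ?R
    unfolding is_convex_comb_def using q(2) by (intro exI[of _ k] exI[of _ t] exI[of _ "fst \<circ> q"]) auto
next
  assume ?R
  then obtain k t p where "is_convex_comb C k t p x" "(\<Sum>j=1..k. t j * f (p j)) = r"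
    by blast
  then show "(x, r) \<in> convex hull ((\<lambda>x. (x, f x)) ` C)"
    unfolding convex_hull_indexed is_convex_comb_def
    by (intro CollectI exI[of _ k] exI[of _ t] exI[of _ "\<lambda>j. (p j, f (p j))"])
      (auto simp: prod_eq_iff fst_sum snd_sum)
qed

corollary convex_roof_eq_Inf_fibre:
  "convex_roof C f x = Inf (ereal ` {r. (x, r) \<in> convex hull ((\<lambda>x. (x, f x)) ` C)})"
  unfolding convex_roof_def convex_hull_graph_eq by (rule arg_cong[of _ _ Inf]) blast

lemma convex_roof_attained:
  fixes C :: "'a::euclidean_space set"
  assumes "compact C" and "continuous_on C f" and "x \<in> convex hull C"
  obtains r where "(x, r) \<in> convex hull ((\<lambda>x. (x, f x)) ` C)" "convex_roof C f x = ereal r"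
proof -
  let ?H = "convex hull ((\<lambda>x. (x, f x)) ` C)"
  have "compact ?H"
    by (intro compact_convex_hull compact_continuous_image continuous_intros assms)
  then have "compact (?H \<inter> {x} \<times> UNIV)"
    by (intro compact_Int_closed closed_Times) auto
  then have cpt: "compact (snd ` (?H \<inter> {x} \<times> UNIV))"
    by (intro compact_continuous_image continuous_intros)
  have "snd ` (?H \<inter> {x} \<times> UNIV) = {r. (x, r) \<in> ?H}"
    by force
  with cpt have cpt: "compact {r. (x, r) \<in> ?H}"
    by simp
  have "fst ` ?H = convex hull C"
    by (simp add: convex_hull_linear_image[OF linear_fst] image_image)
  with assms(3) have "{r. (x, r) \<in> ?H} \<noteq> {}"
    by force
  then obtain r where r: "(x, r) \<in> ?H" "\<And>s. (x, s) \<in> ?H \<Longrightarrow> r \<le> s"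
    using compact_attains_inf[OF cpt] by auto
  have "convex_roof C f x = ereal r"
    unfolding convex_roof_eq_Inf_fibre by (rule Inf_eqI) (use r in auto)
  with r(1) show thesis by (rule that)
qed

text \<open>Prolong the segment from \<open>z\<close> through \<open>x\<close> until it leaves the relative interior. It cannot
  leave strictly before reaching \<open>x\<close>, since every point of the segment other than its end \<open>x\<close>
  is in the relative interior.\<close>

lemma in_segment_to_rel_frontier:
  fixes K :: "'a::euclidean_space set"
  assumes "bounded K" and "convex K" and z: "z \<in> rel_interior K" and x: "x \<in> K" and "x \<noteq> z"
  obtains s y where "s \<in> {0..1}" "y \<in> rel_frontier K" "x = (1 - s) *\<^sub>R z + s *\<^sub>R y"
proof -
  have "z + (x - z) \<in> affine hull K"
    using x by (simp add: hull_inc)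
  then obtain d where "d > 0" and d: "z + d *\<^sub>R (x - z) \<in> rel_frontier K"
    using ray_to_rel_frontier[OF \<open>bounded K\<close> z, of "x - z"] \<open>x \<noteq> z\<close> by auto
  have "1 \<le> d"
  proof (rule ccontr)
    assume "\<not> 1 \<le> d"
    with \<open>d > 0\<close> have "x - (1 - d) *\<^sub>R (x - z) \<in> rel_interior K"
      by (intro rel_interior_convex_shrink assms) auto
    also have "x - (1 - d) *\<^sub>R (x - z) = z + d *\<^sub>R (x - z)"
      by (simp add: algebra_simps)
    finally show False
      using d by (simp add: rel_frontier_def)
  qed
  show thesis
  proof
    show "1 / d \<in> {0..1}" using \<open>1 \<le> d\<close> by simp
    show "z + d *\<^sub>R (x - z) \<in> rel_frontier K" by fact
    show "x = (1 - 1 / d) *\<^sub>R z + (1 / d) *\<^sub>R (z + d *\<^sub>R (x - z))"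
      using \<open>1 \<le> d\<close> by (simp add: algebra_simps)
  qed
qed

text \<open>A convex function lies below the cone spanned by an apex \<open>(z, g z)\<close> and its graph over the
  relative boundary. If \<open>a\<close> is the apex or lies in the relative boundary, the cone has only the
  height \<open>g a\<close> over \<open>a\<close>; since the cone is compact, its heights over points near \<open>a\<close> are at most
  slightly above \<open>g a\<close>, and so is \<open>g\<close>.\<close>

lemma convex_on_upper_semicontinuous:
  fixes g :: "'a::euclidean_space \<Rightarrow> real"
  assumes "compact K" and g: "convex_on K g" and "continuous_on (rel_frontier K) g"
    and a: "a \<in> K" and "g a < b"
  shows "\<exists>d>0. \<forall>x\<in>K. dist x a < d \<longrightarrow> g x < b"
proof -
  have "convex K"
    using g by (rule convex_on_imp_convex)
  have frontier: "rel_frontier K \<subseteq> K"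
    using \<open>compact K\<close> by (simp add: rel_frontier_def compact_imp_closed)
  obtain z where z: "z \<in> rel_interior K" and za: "a \<in> rel_interior K \<Longrightarrow> z = a"
    using rel_interior_eq_empty[OF \<open>convex K\<close>] a by blast
  have "z \<in> K"
    using z rel_interior_subset by blast
  \<comment> \<open>The apex is inserted separately because the relative boundary is empty when \<open>K\<close> is a point.\<close>
  define P where "P = insert (z, g z) ((\<lambda>(s, y). ((1 - s) *\<^sub>R z + s *\<^sub>R y, (1 - s) * g z + s * g y)) `
    ({0..1} \<times> rel_frontier K))"
  have "compact P"
    unfolding P_def case_prod_unfold
    by (intro compact_insert compact_continuous_image compact_Times compact_Icc
        compact_rel_frontier_bounded compact_imp_bounded \<open>compact K\<close> continuous_intros
        continuous_on_compose2[OF assms(3)]) auto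
  moreover have "r \<in> {..<b}" if "(a, r) \<in> P" for r
  proof -
    consider "a = z" "r = g z"
      | s y where "s \<in> {0..1}" "y \<in> rel_frontier K" "a = (1 - s) *\<^sub>R z + s *\<^sub>R y"
        "r = (1 - s) * g z + s * g y"
      using \<open>(a, r) \<in> P\<close> unfolding P_def by auto
    then have "r = g a"
    proof cases
      case 1
      then show ?thesis by simp
    next
      case (2 s y)
      show ?thesis
      proof (cases "a \<in> rel_interior K")
        case True
        have "a = (1 - s) *\<^sub>R a + s *\<^sub>R y"
          using 2(3) za[OF True] by simp
        then have "y = a \<or> s = 0"
          by (auto simp: algebra_simps)
        with True 2(2) have "s = 0"
          by (auto simp: rel_frontier_def)
        with 2 za True show ?thesis by simp
      next
        case False
        \<comment> \<open>A point of a segment from \<open>z\<close> to \<open>y\<close> other than \<open>y\<close> is in the relative interior.\<close>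
        have "s = 1"
        proof (rule ccontr)
          assume "s \<noteq> 1"
          with 2 have "y - (1 - s) *\<^sub>R (y - z) \<in> rel_interior K"
            using frontier by (intro rel_interior_convex_shrink \<open>convex K\<close> z) auto
          also have "y - (1 - s) *\<^sub>R (y - z) = a"
            by (simp add: 2 algebra_simps)
          finally show False
            using False by simp
        qed
        with 2 show ?thesis by simp
      qed
    qed
    with \<open>g a < b\<close> show ?thesis by simp
  qed
  ultimately obtain d where "d > 0"
    and d: "\<And>x r. dist x a < d \<Longrightarrow> (x, r) \<in> P \<Longrightarrow> r \<in> {..<b}"
    using compact_fibre_eventually_subset[of P "{..<b}" a] by auto
  have "g x < b" if "x \<in> K" "dist x a < d" for x
  proof (cases "x = z")
    case True
    with d[of z "g z"] that show ?thesis by (simp add: P_def)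
  next
    case False
    then obtain s y where sy: "s \<in> {0..1}" "y \<in> rel_frontier K" "x = (1 - s) *\<^sub>R z + s *\<^sub>R y"
      using in_segment_to_rel_frontier[OF compact_imp_bounded[OF \<open>compact K\<close>] \<open>convex K\<close> z \<open>x \<in> K\<close>]
      by blast
    have "g x \<le> (1 - s) * g z + s * g y"
      unfolding sy(3) by (rule convex_onD[OF g]) (use sy \<open>z \<in> K\<close> frontier in auto)
    also have "(x, (1 - s) * g z + s * g y) \<in> P"
      unfolding P_def sy(3) using sy(1,2) by force
    with d \<open>dist x a < d\<close> have "(1 - s) * g z + s * g y < b"
      by simp
    finally show ?thesis .
  qed
  with \<open>d > 0\<close> show ?thesis by blast
qed

theorem theorem1p1:
  fixes K C :: "'a::euclidean_space set" and f :: "'a \<Rightarrow> real"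
  assumes "compact K" and "convex K"
    and "closed C" and "C \<subseteq> K"
    and "rel_frontier K \<subseteq> C" and "K = convex hull C"
    and "continuous_on C f" and "convex_fun_on C f"
  shows "\<exists>g :: 'a \<Rightarrow> real.
           (\<forall>x\<in>K. convex_roof C f x = ereal (g x)) \<and>
           continuous_on K g \<and> convex_on K g \<and> (\<forall>x\<in>C. g x = f x)"
proof -
  have "compact C"
    using \<open>compact K\<close> \<open>closed C\<close> \<open>C \<subseteq> K\<close> compact_Int_closed[of K C] by (simp add: Int_absorb1)
  define H where "H = convex hull ((\<lambda>x. (x, f x)) ` C)"
  have "compact H"
    unfolding H_def
    by (intro compact_convex_hull compact_continuous_image continuous_intros
        \<open>compact C\<close> \<open>continuous_on C f\<close>)
  have "\<forall>x\<in>K. \<exists>r. (x, r) \<in> H \<and> convex_roof C f x = ereal r"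
    using convex_roof_attained[OF \<open>compact C\<close> \<open>continuous_on C f\<close>] \<open>K = convex hull C\<close>
    unfolding H_def by metis
  then obtain g where gH: "\<And>x. x \<in> K \<Longrightarrow> (x, g x) \<in> H"
    and roof: "\<And>x. x \<in> K \<Longrightarrow> convex_roof C f x = ereal (g x)"
    by metis
  have g_le: "g x \<le> r" if "x \<in> K" "(x, r) \<in> H" for x r
  proof -
    have "ereal (g x) \<le> ereal r"
      unfolding roof[OF \<open>x \<in> K\<close>, symmetric] convex_roof_eq_Inf_fibre
      using that(2) by (intro Inf_lower) (simp add: H_def)
    then show ?thesis by simp
  qed
  have ext: "g x = f x" if "x \<in> C" for x
  proof (rule antisym)
    have "(x, f x) \<in> H"
      unfolding H_def using that by (intro hull_inc) simp
    then show "g x \<le> f x"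
      using that \<open>C \<subseteq> K\<close> g_le by blast
    have "(x, g x) \<in> H"
      using that \<open>C \<subseteq> K\<close> gH by blast
    then obtain k t p where "is_convex_comb C k t p x" "(\<Sum>j=1..k. t j * f (p j)) = g x"
      unfolding H_def convex_hull_graph_eq by blast
    then show "f x \<le> g x"
      using \<open>convex_fun_on C f\<close> that unfolding convex_fun_on_def by metis
  qed
  have conv: "convex_on K g"
  proof (rule convex_onI[OF _ \<open>convex K\<close>])
    fix t x y assume t: "0 < t" "t < (1::real)" and xy: "x \<in> K" "y \<in> K"
    have "convex H"
      unfolding H_def by (rule convex_convex_hull)
    then have "(1 - t) *\<^sub>R (x, g x) + t *\<^sub>R (y, g y) \<in> H"
      using t xy gH by (intro convexD) auto
    moreover have "(1 - t) *\<^sub>R x + t *\<^sub>R y \<in> K"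
      using t xy by (intro convexD[OF \<open>convex K\<close>]) auto
    ultimately show "g ((1 - t) *\<^sub>R x + t *\<^sub>R y) \<le> (1 - t) * g x + t * g y"
      by (intro g_le) auto
  qed
  have "continuous_on (rel_frontier K) f"
    using \<open>continuous_on C f\<close> \<open>rel_frontier K \<subseteq> C\<close> by (rule continuous_on_subset)
  then have cont_frontier: "continuous_on (rel_frontier K) g"
    using \<open>rel_frontier K \<subseteq> C\<close> ext by (subst continuous_on_cong[OF refl, of _ g f]) auto
  have "continuous_on K g"
    unfolding continuous_on_iff
  proof (intro ballI allI impI)
    fix a and e :: real assume a: "a \<in> K" and "e > 0"
    obtain d1 where "d1 > 0" and d1: "\<And>x. x \<in> K \<Longrightarrow> dist x a < d1 \<Longrightarrow> g x < g a + e"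
      using convex_on_upper_semicontinuous[OF \<open>compact K\<close> conv cont_frontier a, of "g a + e"] \<open>e > 0\<close>
      by auto
    have "r \<in> {g a - e<..}" if "(a, r) \<in> H" for r
      using g_le[OF a that] \<open>e > 0\<close> by simp
    then obtain d2 where "d2 > 0"
      and d2: "\<And>x r. dist x a < d2 \<Longrightarrow> (x, r) \<in> H \<Longrightarrow> r \<in> {g a - e<..}"
      using compact_fibre_eventually_subset[OF \<open>compact H\<close> open_greaterThan[of "g a - e"], of a] by metis
    show "\<exists>d>0. \<forall>x\<in>K. dist x a < d \<longrightarrow> dist (g x) (g a) < e"
    proof (intro exI[of _ "min d1 d2"] conjI ballI impI)
      fix x assume "x \<in> K" "dist x a < min d1 d2"
      then have "g x < g a + e" "g a - e < g x"
        using d1[of x] d2[of x "g x"] gH[of x] by auto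
      then show "dist (g x) (g a) < e"
        by (simp add: dist_real_def abs_less_iff)
    qed (use \<open>d1 > 0\<close> \<open>d2 > 0\<close> in simp)
  qed
  with roof conv ext show ?thesis by blast
qed

end
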